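(* Let $\mathcal{H}$ be a separable Hilbert space, $\mathbb{I}$ a finite or countably infinite index set, $m\in\mathbb{N}$, and let $F=\{f_{ij}\}_{i\in\mathbb{I},j\in[m]}$ be a woven frame for $\mathcal{H}$ with universal woven bounds $C$ and $D$. For a partition $\sigma=\{\sigma_j\}_{j\in[m]}$ of $\mathbb{I}$ let $S_F=S_{F,\sigma}$ be the woven frame operator of $F$ and let $S_F^{-1/2}$ be the positive square root of $S_F^{-1}$. Then $\{S_F^{-1/2}f_{ij}\}$ is a tight woven frame, i.e. there is a constant $A>0$, independent of the partition, such that for every partition $\sigma$ the family $\{S_F^{-1/2}f_{ij}\}_{i\in\sigma_j,j\in[m]}$ is a tight frame for $\mathcal{H}$ with bound $A$; and for every partition $\sigma$ and all $f\in\mathcal{H}$, $$f=\sum_{j\in[m]}\sum_{i\in\sigma_j}\langle f,S_F^{-1/2}f_{ij}\rangle S_F^{-1/2}f_{ij}.$$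
   Context: $[m]=\{1,\dots,m\}$. A partition $\{\sigma_j\}_{j\in[m]}$ of $\mathbb{I}$ consists of pairwise disjoint, possibly empty subsets of $\mathbb{I}$ with union $\mathbb{I}$. A sequence $\{f_i\}$ is a frame for $\mathcal{H}$ with bounds $0<A,B<\infty$ if $A\|f\|^2\le\sum_i|\langle f,f_i\rangle|^2\le B\|f\|^2$ for all $f\in\mathcal{H}$, and a tight frame with bound $A$ if $A=B$. The family $\{f_{ij}\}_{i\in\mathbb{I},j\in[m]}$ is a woven frame for $\mathcal{H}$ with universal bounds $C,D>0$ if each $\{f_{ij}\}_{i\in\mathbb{I}}$ ($j\in[m]$) is a frame for $\mathcal{H}$ and for every partition $\{\sigma_j\}_{j\in[m]}$ of $\mathbb{I}$ the family $\{f_{ij}\}_{i\in\sigma_j,j\in[m]}$ is a frame for $\mathcal{H}$ with bounds $C,D$. The woven frame operator (for the partition $\sigma$) is $S_{F}f=\sum_{j\in[m]}\sum_{i\in\sigma_j}\langle f,f_{ij}\rangle f_{ij}$, which is bounded, positive and invertible on $\mathcal{H}$. *)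

theory Defs
  imports "HOL-Analysis.Analysis"
begin

(* The scalar field is real or complex.  The last axiom forces "kconj" to be the
   identity on real and "cnj" on complex; every real normed field is one of the two
   up to isomorphism (Gelfand-Mazur). *)
class rc_field = real_normed_field +
  fixes kconj :: "'a \<Rightarrow> 'a"
  assumes kconj_add: "kconj (x + y) = kconj x + kconj y"
    and kconj_mult: "kconj (x * y) = kconj x * kconj y"
    and kconj_kconj: "kconj (kconj x) = x"
    and mult_kconj: "x * kconj x = (norm x)\<^sup>2 *\<^sub>R 1"

instantiation real :: rc_field
begin
definition kconj_real :: "real \<Rightarrow> real" where "kconj_real x = x"
instance by standard (simp_all add: kconj_real_def power2_eq_square)
end

instantiation complex :: rc_field
begin
definition kconj_complex :: "complex \<Rightarrow> complex" where "kconj_complex x = cnj x"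
instance
  by standard (simp_all add: kconj_complex_def scaleR_conv_of_real complex_norm_square del: of_real_power)
end

(* A Hilbert space over the field 'k on the whole type 'a.  Completeness comes from the
   class banach, whose norm is the one induced by the inner product "ip"
   (linear in its first argument). *)
locale hilbert_space = vector_space smul
  for smul :: "'k::rc_field \<Rightarrow> 'a::banach \<Rightarrow> 'a" +
  fixes ip :: "'a \<Rightarrow> 'a \<Rightarrow> 'k"
  assumes scale_of_real: "smul (of_real r) x = r *\<^sub>R x"
    and ip_add_left: "ip (x + y) z = ip x z + ip y z"
    and ip_scale_left: "ip (smul c x) y = c * ip x y"
    and ip_kconj: "ip y x = kconj (ip x y)"
    and ip_self: "ip x x = of_real ((norm x)\<^sup>2)"

lemma hilbert_space_real:
  "hilbert_space (scaleR :: real \<Rightarrow> 'a \<Rightarrow> 'a) (inner :: 'a::{real_inner,banach} \<Rightarrow> 'a \<Rightarrow> real)"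
  by unfold_locales
    (simp_all add: kconj_real_def inner_add_left inner_commute power2_norm_eq_inner algebra_simps)

lemma hilbert_space_complex:
  "hilbert_space ((*) :: complex \<Rightarrow> complex \<Rightarrow> complex) (\<lambda>x y. x * cnj y)"
  by unfold_locales
    (simp_all add: kconj_complex_def complex_norm_square scaleR_conv_of_real algebra_simps
      del: of_real_power)

(* Summability is required explicitly since infsum is 0 for divergent sums. *)
definition is_frame :: "('a::real_normed_vector \<Rightarrow> 'a \<Rightarrow> 'k::real_normed_field) \<Rightarrow> 'j set \<Rightarrow>
    ('j \<Rightarrow> 'a) \<Rightarrow> real \<Rightarrow> real \<Rightarrow> bool" where
  "is_frame ip K g A B \<longleftrightarrow> 0 < A \<and> 0 < B \<and>
     (\<forall>x. (\<lambda>k. (norm (ip x (g k)))\<^sup>2) summable_on K \<and>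
          A * (norm x)\<^sup>2 \<le> (\<Sum>\<^sub>\<infinity>k\<in>K. (norm (ip x (g k)))\<^sup>2) \<and>
          (\<Sum>\<^sub>\<infinity>k\<in>K. (norm (ip x (g k)))\<^sup>2) \<le> B * (norm x)\<^sup>2)"

definition is_tight_frame :: "('a::real_normed_vector \<Rightarrow> 'a \<Rightarrow> 'k::real_normed_field) \<Rightarrow>
    'j set \<Rightarrow> ('j \<Rightarrow> 'a) \<Rightarrow> real \<Rightarrow> bool" where
  "is_tight_frame ip K g A \<longleftrightarrow> is_frame ip K g A A"

definition index_partition :: "'i set \<Rightarrow> nat \<Rightarrow> (nat \<Rightarrow> 'i set) \<Rightarrow> bool" where
  "index_partition I m \<sigma> \<longleftrightarrow> disjoint_family_on \<sigma> {1..m} \<and> (\<Union>j\<in>{1..m}. \<sigma> j) = I"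

(* The family (f i j) with i in \<sigma> j and j in [m] is indexed by the pairs (j, i). *)
definition is_woven_frame :: "('a::real_normed_vector \<Rightarrow> 'a \<Rightarrow> 'k::real_normed_field) \<Rightarrow>
    'i set \<Rightarrow> nat \<Rightarrow> ('i \<Rightarrow> nat \<Rightarrow> 'a) \<Rightarrow> real \<Rightarrow> real \<Rightarrow> bool" where
  "is_woven_frame ip I m f C D \<longleftrightarrow> 0 < C \<and> 0 < D \<and>
     (\<forall>j\<in>{1..m}. \<exists>A B. is_frame ip I (\<lambda>i. f i j) A B) \<and>
     (\<forall>\<sigma>. index_partition I m \<sigma> \<longrightarrow>
        is_frame ip (SIGMA j:{1..m}. \<sigma> j) (\<lambda>(j, i). f i j) C D)"

definition woven_frame_operator :: "('k \<Rightarrow> 'a \<Rightarrow> 'a) \<Rightarrow> ('a::real_normed_vector \<Rightarrow> 'a \<Rightarrow> 'k) \<Rightarrow>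
    nat \<Rightarrow> ('i \<Rightarrow> nat \<Rightarrow> 'a) \<Rightarrow> (nat \<Rightarrow> 'i set) \<Rightarrow> 'a \<Rightarrow> 'a" where
  "woven_frame_operator smul ip m f \<sigma> x =
     (\<Sum>j\<in>{1..m}. \<Sum>\<^sub>\<infinity>i\<in>\<sigma> j. smul (ip x (f i j)) (f i j))"

(* Self-adjointness is automatic over the complex numbers, but not over the reals. *)
definition positive_operator :: "('k::real_normed_field \<Rightarrow> 'a \<Rightarrow> 'a) \<Rightarrow>
    ('a::real_normed_vector \<Rightarrow> 'a \<Rightarrow> 'k) \<Rightarrow> ('a \<Rightarrow> 'a) \<Rightarrow> bool" where
  "positive_operator smul ip T \<longleftrightarrow>
     bounded_linear T \<and> (\<forall>c x. T (smul c x) = smul c (T x)) \<and>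
     (\<forall>x y. ip (T x) y = ip x (T y)) \<and>
     (\<forall>x. \<exists>r\<ge>0. ip (T x) x = of_real r)"

definition positive_sqrt :: "('k::real_normed_field \<Rightarrow> 'a \<Rightarrow> 'a) \<Rightarrow>
    ('a::real_normed_vector \<Rightarrow> 'a \<Rightarrow> 'k) \<Rightarrow> ('a \<Rightarrow> 'a) \<Rightarrow> 'a \<Rightarrow> 'a" where
  "positive_sqrt smul ip T = (THE R. positive_operator smul ip R \<and> R \<circ> R = T)"

definition inv_sqrt_frame_operator :: "('k::real_normed_field \<Rightarrow> 'a \<Rightarrow> 'a) \<Rightarrow>
    ('a::real_normed_vector \<Rightarrow> 'a \<Rightarrow> 'k) \<Rightarrow>
    nat \<Rightarrow> ('i \<Rightarrow> nat \<Rightarrow> 'a) \<Rightarrow> (nat \<Rightarrow> 'i set) \<Rightarrow> 'a \<Rightarrow> 'a" where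
  "inv_sqrt_frame_operator smul ip m f \<sigma> =
     positive_sqrt smul ip (inv (woven_frame_operator smul ip m f \<sigma>))"

end

(* Fix a partition and let S be the woven frame operator. It is self-adjoint with
   <S x, x> = sum |<x, f_ij>|^2 >= C |x|^2, so S and S^{-1} are bounded, coercive and invertible.
   A coercive operator has a positive square root, found by a contraction argument in place of the
   spectral theorem; this root commutes with everything that commutes with the operator, and
   therefore is the only one. For R = S^{-1/2} one gets R S R = 1, hence
   sum |<x, R f_ij>|^2 = <S R x, R x> = |x|^2 and sum <x, R f_ij> R f_ij = R S R x = x.
   So the tight bound is A = 1 for every partition. *)
theory Submission
  imports Defs
begin

section \<open>Conjugation and real part in the scalar field\<close>

text \<open>The real part is read off from \<open>\<bar>c + 1\<bar>\<^sup>2 = \<bar>c\<bar>\<^sup>2 + 2 Re c + 1\<close>.\<close>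
definition re_part :: "'k::rc_field \<Rightarrow> real" where
  "re_part c = ((norm (c + 1))\<^sup>2 - (norm c)\<^sup>2 - 1) / 2"

lemma kconj_0 [simp]: "kconj (0::'k::rc_field) = 0"
  using kconj_add[of "0::'k" 0] by simp

lemma kconj_of_real [simp]: "kconj (of_real r :: 'k::rc_field) = of_real r"
proof (cases "r = 0")
  case False
  have "(of_real r :: 'k) * kconj (of_real r) = of_real r * of_real r"
    unfolding mult_kconj by (simp add: scaleR_conv_of_real power2_eq_square flip: of_real_mult)
  with False show ?thesis by simp
qed simp

text \<open>Since \<open>kconj\<close> is an involution, \<open>c * kconj c\<close> is symmetric in
  \<open>c\<close> and \<open>kconj c\<close>; \<open>mult_kconj\<close> applied to both gives equal
  squared norms.\<close>

lemma norm_kconj [simp]: "norm (kconj (c::'k::rc_field)) = norm c"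
proof -
  have "c * kconj c = kconj c * kconj (kconj c)"
    by (simp add: kconj_kconj mult.commute)
  then have "of_real ((norm c)\<^sup>2) = (of_real ((norm (kconj c))\<^sup>2) :: 'k)"
    unfolding mult_kconj by (simp add: scaleR_conv_of_real)
  then have "(norm c)\<^sup>2 = (norm (kconj c))\<^sup>2"
    by (simp only: of_real_eq_iff)
  then show ?thesis by simp
qed

text \<open>Expanding \<open>(c + 1) * kconj (c + 1)\<close> links the norm-based
  \<open>re_part\<close> to conjugation. The algebraic rules for \<open>re_part\<close> below are
  read off from this identity.\<close>

lemma add_kconj: "c + kconj c = of_real (2 * re_part (c::'k::rc_field))"
proof -
  have "(c + 1) * kconj (c + 1) = c * kconj c + c + kconj c + 1"
    using kconj_of_real[of 1, where 'k='k] by (simp add: kconj_add algebra_simps)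
  then have "c + kconj c = (c + 1) * kconj (c + 1) - c * kconj c - 1"
    by simp
  also have "\<dots> = of_real (2 * re_part c)"
    unfolding mult_kconj re_part_def by (simp add: scaleR_conv_of_real)
  finally show ?thesis .
qed

lemma re_part_add: "re_part (x + y) = re_part x + re_part (y::'k::rc_field)"
proof -
  have "of_real (2 * re_part (x + y)) = (of_real (2 * (re_part x + re_part y)) :: 'k)"
    unfolding add_kconj[symmetric] distrib_left of_real_add kconj_add by (simp add: algebra_simps)
  then have "2 * re_part (x + y) = 2 * (re_part x + re_part y)"
    by (simp only: of_real_eq_iff)
  then show ?thesis by simp
qed

lemma re_part_of_real_mult: "re_part (of_real r * c) = r * re_part (c::'k::rc_field)"
proof -
  have "of_real (2 * re_part (of_real r * c)) = of_real r * (c + kconj c)"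
    unfolding add_kconj[symmetric] by (simp add: kconj_mult algebra_simps)
  also have "\<dots> = of_real (r * (2 * re_part c))"
    unfolding add_kconj by simp
  finally have "2 * re_part (of_real r * c) = r * (2 * re_part c)"
    by (simp only: of_real_eq_iff)
  then show ?thesis by simp
qed

lemma re_part_of_real [simp]: "re_part (of_real r :: 'k::rc_field) = r"
  using add_kconj[of "of_real r :: 'k"] by (simp flip: of_real_add of_real_mult)

lemma re_part_kconj [simp]: "re_part (kconj (c::'k::rc_field)) = re_part c"
  using add_kconj[of c] add_kconj[of "kconj c"] by (simp add: kconj_kconj add.commute)

lemma of_real_re_part: "kconj c = c \<Longrightarrow> of_real (re_part c) = (c::'k::rc_field)"
  using add_kconj[of c] by (simp flip: mult_2)

lemma abs_re_part_le: "\<bar>re_part (c::'k::rc_field)\<bar> \<le> norm c"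
proof -
  have "norm (of_real (2 * re_part c) :: 'k) \<le> norm c + norm (kconj c)"
    unfolding add_kconj[symmetric] by (rule norm_triangle_ineq)
  then show ?thesis by (simp add: abs_mult)
qed

lemma linear_re_part: "linear (re_part :: 'k::rc_field \<Rightarrow> real)"
  by (rule linearI) (simp_all add: re_part_add re_part_of_real_mult scaleR_conv_of_real)

section \<open>Inner product geometry over both scalar fields\<close>

context hilbert_space
begin

lemma ip_add_right: "ip x (y + z) = ip x y + ip x z"
  by (metis ip_kconj ip_add_left kconj_add)

lemma ip_scale_right: "ip x (smul c y) = kconj c * ip x y"
  by (metis ip_kconj ip_scale_left kconj_mult)

lemma norm_scale: "norm (smul c x) = norm c * norm x"
proof -
  have "of_real ((norm (smul c x))\<^sup>2) = (c * kconj c) * ip x x"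
    unfolding ip_self[symmetric] ip_scale_left ip_scale_right by (simp add: mult.assoc)
  also have "\<dots> = of_real ((norm c * norm x)\<^sup>2)"
    unfolding mult_kconj ip_self by (simp add: scaleR_conv_of_real power_mult_distrib)
  finally have "(norm (smul c x))\<^sup>2 = (norm c * norm x)\<^sup>2"
    by (simp only: of_real_eq_iff)
  then show ?thesis by simp
qed

lemma bounded_linear_scale: "bounded_linear (smul c)"
proof (rule bounded_linear_intro[where K = "norm c"])
  show "smul c (r *\<^sub>R x) = r *\<^sub>R smul c x" for r x
    by (simp add: scale_left_commute flip: scale_of_real)
qed (simp_all add: scale_right_distrib norm_scale mult.commute)

text \<open>A real inner product inducing the same norm, so that estimates of quadratic forms can be
  carried out over the reals.\<close>

definition rip :: "'a \<Rightarrow> 'a \<Rightarrow> real" where "rip x y = re_part (ip x y)"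

lemma rip_commute: "rip x y = rip y x"
  unfolding rip_def by (metis ip_kconj re_part_kconj)

lemma rip_add_left: "rip (x + y) z = rip x z + rip y z"
  by (simp add: rip_def ip_add_left re_part_add)

lemma rip_scaleR_left: "rip (r *\<^sub>R x) y = r * rip x y"
  by (simp add: rip_def ip_scale_left re_part_of_real_mult flip: scale_of_real)

lemma rip_self: "rip x x = (norm x)\<^sup>2"
  by (simp add: rip_def ip_self del: of_real_power)

lemma linear_rip_left: "linear (\<lambda>x. rip x y)"
  by (rule linearI) (simp_all add: rip_add_left rip_scaleR_left)

lemma rip_diff_left: "rip (x - y) z = rip x z - rip y z"
  using linear_diff[OF linear_rip_left] .

lemma rip_diff_right: "rip z (x - y) = rip z x - rip z y"
  by (metis rip_commute rip_diff_left)

lemma rip_scaleR_right: "rip x (r *\<^sub>R y) = r * rip x y"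
  by (metis rip_commute rip_scaleR_left)

text \<open>Cauchy-Schwarz: with \<open>c = ip x y\<close>, the squared norm of
  \<open>r *\<^sub>R x - smul c y\<close> is a nonnegative quadratic polynomial in the real number
  \<open>r\<close>.\<close>

lemma norm_ip_le: "norm (ip x y) \<le> norm x * norm y"
proof -
  define c where "c = ip x y"
  have "0 \<le> rip (r *\<^sub>R x - smul c y) (r *\<^sub>R x - smul c y)" for r
    by (simp add: rip_self)
  \<comment> \<open>The factor \<open>c\<close> turns the phase of the cross term, making it real
    and nonnegative.\<close>
  moreover have "rip (smul c y) x = (norm c)\<^sup>2"
  proof -
    have "ip (smul c y) x = c * kconj c"
      by (simp add: c_def ip_scale_left ip_kconj[of y x])
    then show ?thesis
      by (simp add: rip_def mult_kconj scaleR_conv_of_real del: of_real_power)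
  qed
  ultimately have q: "0 \<le> r\<^sup>2 * (norm x)\<^sup>2 - 2 * r * (norm c)\<^sup>2 + (norm c)\<^sup>2 * (norm y)\<^sup>2" for r
    unfolding rip_diff_left rip_diff_right rip_scaleR_left rip_scaleR_right
      rip_commute[of x "smul c y"]
    by (simp add: rip_self norm_scale power_mult_distrib power2_eq_square algebra_simps)
  show ?thesis
  proof (cases "x = 0")
    case True
    then show ?thesis using ip_scale_left[of 0 0 y] by simp
  next
    case False
    then have n: "(norm x)\<^sup>2 > 0" by simp
    \<comment> \<open>The value of \<open>r\<close> inserted here is the minimiser of the
      quadratic.\<close>
    have "0 \<le> ((norm c)\<^sup>2 / (norm x)\<^sup>2)\<^sup>2 * (norm x)\<^sup>2 - 2 * ((norm c)\<^sup>2 / (norm x)\<^sup>2) * (norm c)\<^sup>2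
        + (norm c)\<^sup>2 * (norm y)\<^sup>2" by (rule q)
    also have "\<dots> = (norm c)\<^sup>2 * ((norm x * norm y)\<^sup>2 - (norm c)\<^sup>2) / (norm x)\<^sup>2"
      using False by (simp add: field_simps power2_eq_square)
    finally have "0 \<le> (norm c)\<^sup>2 * ((norm x * norm y)\<^sup>2 - (norm c)\<^sup>2)"
      using n by (simp add: zero_le_divide_iff)
    then have "c = 0 \<or> (norm c)\<^sup>2 \<le> (norm x * norm y)\<^sup>2"
      by (auto simp: zero_le_mult_iff)
    then show ?thesis
      unfolding c_def[symmetric] by (auto intro: power2_le_imp_le)
  qed
qed

lemma bounded_linear_ip_left: "bounded_linear (\<lambda>x. ip x y)"
proof (rule bounded_linear_intro[where K = "norm y"])
  show "ip (r *\<^sub>R x) y = r *\<^sub>R ip x y" for r x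
    by (simp add: ip_scale_left scaleR_conv_of_real flip: scale_of_real)
qed (simp_all add: ip_add_left norm_ip_le)

lemma bounded_linear_ip_right: "bounded_linear (ip x)"
proof (rule bounded_linear_intro[where K = "norm x"])
  show "ip x (r *\<^sub>R y) = r *\<^sub>R ip x y" for r y
    by (simp add: ip_scale_right scaleR_conv_of_real flip: scale_of_real)
  show "norm (ip x y) \<le> norm y * norm x" for y
    using norm_ip_le[of x y] by (simp add: mult.commute)
qed (simp add: ip_add_right)

lemma rip_le: "rip x y \<le> norm x * norm y"
  using abs_re_part_le[of "ip x y"] norm_ip_le[of x y] by (simp add: rip_def)

lemma ip_diff: "ip (x - y) z = ip x z - ip y z" "ip z (x - y) = ip z x - ip z y"
  using linear_diff[OF bounded_linear.linear[OF bounded_linear_ip_left]]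
    linear_diff[OF bounded_linear.linear[OF bounded_linear_ip_right]] by blast+

section \<open>Positive operators\<close>

lemma positive_operatorD:
  assumes "positive_operator smul ip T"
  shows "bounded_linear T" "T (smul c x) = smul c (T x)" "ip (T x) y = ip x (T y)"
    "rip (T x) y = rip x (T y)" "0 \<le> rip (T x) x"
proof -
  obtain r where "r \<ge> 0" "ip (T x) x = of_real r"
    using assms unfolding positive_operator_def by blast
  then show "0 \<le> rip (T x) x" by (simp add: rip_def)
qed (use assms in \<open>auto simp: positive_operator_def rip_def\<close>)

text \<open>Self-adjointness makes \<open>ip (T x) x\<close> equal to its conjugate, hence real, so
  only the sign of its real part remains to be checked.\<close>

lemma positive_operatorI:
  assumes "bounded_linear T" "\<And>c x. T (smul c x) = smul c (T x)"
    "\<And>x y. ip (T x) y = ip x (T y)" "\<And>x. 0 \<le> rip (T x) x"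
  shows "positive_operator smul ip T"
proof -
  have "ip (T x) x = of_real (rip (T x) x)" for x
    unfolding rip_def by (rule of_real_re_part[symmetric]) (metis assms(3) ip_kconj)
  then show ?thesis
    using assms unfolding positive_operator_def by blast
qed

text \<open>Expand \<open>0 \<le> \<langle>A (x - t A x), x - t A x\<rangle>\<close> at \<open>t = 1 / r\<close>.\<close>
lemma norm_positive_operator_le:
  assumes A: "positive_operator smul ip A"
    and r: "r > 0" and le: "\<And>x. rip (A x) x \<le> r * (norm x)\<^sup>2"
  shows "norm (A x) \<le> r * norm x"
proof -
  interpret A: bounded_linear A by (rule positive_operatorD[OF A])
  define y where "y = x - (1 / r) *\<^sub>R A x"
  have "0 \<le> rip (A y) y" by (rule positive_operatorD[OF A])
  also have "\<dots> = rip (A x) x - 2 / r * (norm (A x))\<^sup>2 + 1 / r\<^sup>2 * rip (A (A x)) (A x)"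
    using positive_operatorD(4)[OF A, of "A x" x]
    by (simp add: y_def A.diff A.scaleR rip_diff_left rip_diff_right rip_scaleR_left
        rip_scaleR_right rip_self power2_eq_square algebra_simps)
  \<comment> \<open>The form bound \<open>le\<close> is used twice, at \<open>x\<close> and at
    \<open>A x\<close>.\<close>
  also have "\<dots> \<le> r * (norm x)\<^sup>2 - 2 / r * (norm (A x))\<^sup>2 + 1 / r\<^sup>2 * (r * (norm (A x))\<^sup>2)"
    using r by (intro add_mono diff_right_mono mult_left_mono le) auto
  also have "\<dots> = ((r * norm x)\<^sup>2 - (norm (A x))\<^sup>2) / r"
    using r by (simp add: field_simps power2_eq_square)
  finally have "(norm (A x))\<^sup>2 \<le> (r * norm x)\<^sup>2"
    using r by (simp add: zero_le_divide_iff)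
  then show ?thesis using r by (auto intro: power2_le_imp_le)
qed

section \<open>Inverse and positive square root of a coercive operator\<close>

text \<open>The last clause places \<open>Y\<close> in the bicommutant of \<open>X\<close>. Building
  it into the domain of the fixed-point iteration makes the square root commute with everything that
  commutes with \<open>X\<close>.\<close>

definition selfadjoint_commuting_ball :: "('a \<Rightarrow>\<^sub>L 'a) \<Rightarrow> real \<Rightarrow> ('a \<Rightarrow>\<^sub>L 'a) set" where
  "selfadjoint_commuting_ball X r = {Y. norm Y \<le> r \<and>
     (\<forall>c x. blinfun_apply Y (smul c x) = smul c (blinfun_apply Y x)) \<and>
     (\<forall>x y. ip (blinfun_apply Y x) y = ip x (blinfun_apply Y y)) \<and>
     (\<forall>Z. Z o\<^sub>L X = X o\<^sub>L Z \<longrightarrow> Z o\<^sub>L Y = Y o\<^sub>L Z)}"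

lemma selfadjoint_commuting_ballD:
  assumes "Y \<in> selfadjoint_commuting_ball X r"
  shows "norm Y \<le> r" "blinfun_apply Y (smul c x) = smul c (blinfun_apply Y x)"
    "ip (blinfun_apply Y x) y = ip x (blinfun_apply Y y)"
    "Z o\<^sub>L X = X o\<^sub>L Z \<Longrightarrow> Z o\<^sub>L Y = Y o\<^sub>L Z"
  using assms unfolding selfadjoint_commuting_ball_def by auto

text \<open>Every clause is a closed condition, an equality or inequality between continuous
  functions of \<open>Y\<close>. Closedness supplies the completeness needed for the fixed-point
  theorem.\<close>

lemma closed_selfadjoint_commuting_ball: "closed (selfadjoint_commuting_ball X r)"
proof -
  note lin [continuous_intros] = bounded_linear.continuous_on[OF bounded_linear_scale]
    bounded_linear.continuous_on[OF bounded_linear_ip_left]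
    bounded_linear.continuous_on[OF bounded_linear_ip_right]
  show ?thesis
    unfolding selfadjoint_commuting_ball_def
    by (intro closed_Collect_conj closed_Collect_all closed_Collect_imp open_Collect_const
        closed_Collect_le closed_Collect_eq continuous_intros)
qed

text \<open>A square root \<open>1 - Y\<close> of \<open>1 - X\<close> is a fixed point of \<open>Y \<mapsto> (X + Y\<^sup>2) / 2\<close>.\<close>
lemma sqrt_fixed_point:
  fixes X :: "'a \<Rightarrow>\<^sub>L 'a"
  assumes r: "0 < r" "r < 1" and X: "X \<in> selfadjoint_commuting_ball X r"
  obtains Y where "Y \<in> selfadjoint_commuting_ball X r" "2 *\<^sub>R Y = X + (Y o\<^sub>L Y)"
proof -
  let ?S = "selfadjoint_commuting_ball X r"
  define \<Phi> where "\<Phi> Y = (1 / 2) *\<^sub>R (X + (Y o\<^sub>L Y))" for Y :: "'a \<Rightarrow>\<^sub>L 'a"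
  have "\<Phi> Y \<in> ?S" if Y: "Y \<in> ?S" for Y
  proof -
    have "norm (Y o\<^sub>L Y) \<le> r * r"
      using selfadjoint_commuting_ballD(1)[OF Y] r
      by (intro order.trans[OF norm_blinfun_compose] mult_mono) auto
    also have "\<dots> \<le> r" using r by (simp add: mult_left_le)
    finally have "norm (\<Phi> Y) \<le> r"
      using norm_triangle_ineq[of X "Y o\<^sub>L Y"] selfadjoint_commuting_ballD(1)[OF X]
      by (simp add: \<Phi>_def)
    moreover have "\<Phi> Y (smul c x) = smul c (\<Phi> Y x)" for c x
      by (simp add: \<Phi>_def selfadjoint_commuting_ballD(2)[OF X] selfadjoint_commuting_ballD(2)[OF Y]
          blinfun.bilinear_simps scale_right_distrib mult.commute flip: scale_of_real)
    moreover have "ip (\<Phi> Y x) y = ip x (\<Phi> Y y)" for x y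
      by (simp add: \<Phi>_def selfadjoint_commuting_ballD(3)[OF X] selfadjoint_commuting_ballD(3)[OF Y]
          blinfun.bilinear_simps ip_add_left ip_add_right ip_scale_left ip_scale_right
          del: of_real_divide flip: scale_of_real)
    moreover have "Z o\<^sub>L \<Phi> Y = \<Phi> Y o\<^sub>L Z" if "Z o\<^sub>L X = X o\<^sub>L Z" for Z
    proof -
      have "Z o\<^sub>L Y = Y o\<^sub>L Z"
        by (rule selfadjoint_commuting_ballD(4)[OF Y that])
      then have "Z (Y x) = Y (Z x)" "Z (X x) = X (Z x)" for x
        using that by (metis blinfun_apply_blinfun_compose)+
      then show ?thesis
        by (intro blinfun_eqI) (simp add: \<Phi>_def blinfun.bilinear_simps)
    qed
    ultimately show ?thesis by (simp add: selfadjoint_commuting_ball_def)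
  qed
  moreover have "dist (\<Phi> Y) (\<Phi> Z) \<le> r * dist Y Z" if YZ: "Y \<in> ?S" "Z \<in> ?S" for Y Z
  proof -
    have n: "norm Y \<le> r" "norm Z \<le> r"
      using YZ by (blast dest: selfadjoint_commuting_ballD(1))+
    \<comment> \<open>A difference of squares that does not assume \<open>Y\<close> and
      \<open>Z\<close> commute. Each summand contributes a factor \<open>r\<close>, and the 1/2 in
      \<open>\<Phi>\<close> leaves Lipschitz constant \<open>r\<close>.\<close>
    have "(Y o\<^sub>L Y) - (Z o\<^sub>L Z) = (Y o\<^sub>L (Y - Z)) + ((Y - Z) o\<^sub>L Z)"
      by (intro blinfun_eqI) (simp add: blinfun.bilinear_simps)
    also have "norm \<dots> \<le> norm Y * norm (Y - Z) + norm (Y - Z) * norm Z"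
      by (intro order.trans[OF norm_triangle_ineq] add_mono norm_blinfun_compose)
    also have "\<dots> \<le> r * norm (Y - Z) + norm (Y - Z) * r"
      using n by (intro add_mono mult_right_mono mult_left_mono) auto
    finally have "norm ((Y o\<^sub>L Y) - (Z o\<^sub>L Z)) \<le> 2 * (r * dist Y Z)"
      by (simp add: dist_norm mult.commute)
    moreover have "\<Phi> Y - \<Phi> Z = (1 / 2) *\<^sub>R ((Y o\<^sub>L Y) - (Z o\<^sub>L Z))"
      by (simp add: \<Phi>_def algebra_simps)
    ultimately show ?thesis by (simp add: dist_norm)
  qed
  moreover have "complete ?S"
    using closed_selfadjoint_commuting_ball by (simp add: complete_eq_closed)
  ultimately obtain Y where Y: "Y \<in> ?S" "\<Phi> Y = Y"
    using Banach_fix[of ?S r \<Phi>] X r by (auto simp: image_subset_iff)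
  have "2 *\<^sub>R Y = 2 *\<^sub>R \<Phi> Y" using Y by simp
  also have "\<dots> = X + (Y o\<^sub>L Y)" by (simp add: \<Phi>_def)
  finally show thesis using that Y by blast
qed

text \<open>If \<open>b\<close> bounds the form of \<open>T\<close> from above, then 1 - T/b has its
  form between 0 and 1 - a/b, and for positive operators the form bound is a norm bound. Inversion
  and square root both start from this contraction.\<close>

lemma coercive_contraction:
  assumes T: "positive_operator smul ip T"
    and a: "a > 0" and coercive: "\<And>x. a * (norm x)\<^sup>2 \<le> rip (T x) x"
  obtains b r where "0 < b" "0 < r" "r < 1"
    "positive_operator smul ip (\<lambda>x. x - (1 / b) *\<^sub>R T x)"
    "\<And>x. norm (x - (1 / b) *\<^sub>R T x) \<le> r * norm x"
proof -
  interpret T: bounded_linear T by (rule positive_operatorD[OF T])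
  obtain K where K: "\<And>x. norm (T x) \<le> norm x * K" using T.bounded by blast
  \<comment> \<open>Taking \<open>max a K\<close> and adding 1 ensures \<open>a < b\<close>, so that
    \<open>r\<close> lies strictly between 0 and 1.\<close>
  define b where "b = max a K + 1"
  define r where "r = 1 - a / b"
  have b: "0 < b" "a < b" using a by (auto simp: b_def)
  then have r: "0 < r" "r < 1" using a by (auto simp: r_def field_simps)
  have upper: "rip (T x) x \<le> b * (norm x)\<^sup>2" for x
  proof -
    have "rip (T x) x \<le> norm (T x) * norm x" by (rule rip_le)
    also have "\<dots> \<le> (norm x * K) * norm x" by (intro mult_right_mono K) auto
    also have "\<dots> = K * (norm x)\<^sup>2" by (simp add: power2_eq_square)
    also have "\<dots> \<le> b * (norm x)\<^sup>2" by (intro mult_right_mono) (auto simp: b_def)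
    finally show ?thesis .
  qed
  define X0 where "X0 x = x - (1 / b) *\<^sub>R T x" for x
  have X0: "positive_operator smul ip X0"
  proof (rule positive_operatorI)
    show "bounded_linear X0"
      unfolding X0_def by (intro bounded_linear_intros T.bounded_linear_axioms)
    show "X0 (smul c x) = smul c (X0 x)" for c x
      by (simp add: X0_def positive_operatorD[OF T] scale_right_diff_distrib scale_left_commute
          flip: scale_of_real)
    show "ip (X0 x) y = ip x (X0 y)" for x y
      by (simp add: X0_def positive_operatorD(3)[OF T] ip_diff ip_scale_left ip_scale_right
          del: of_real_divide flip: scale_of_real)
    show "0 \<le> rip (X0 x) x" for x
      using upper[of x] b by (simp add: X0_def rip_diff_left rip_scaleR_left rip_self field_simps)
  qed
  have "rip (X0 x) x \<le> r * (norm x)\<^sup>2" for x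
    using coercive[of x] b
    by (simp add: X0_def rip_diff_left rip_scaleR_left rip_self r_def field_simps)
  then have "norm (X0 x) \<le> r * norm x" for x
    using norm_positive_operator_le[OF X0 r(1)] by blast
  with X0 b(1) r show thesis
    unfolding X0_def using that by blast
qed

text \<open>\<open>T x = y\<close> says that \<open>x\<close> is fixed by the contraction \<open>x \<mapsto> x - T x / b + y / b\<close>.\<close>
lemma coercive_bij:
  assumes T: "positive_operator smul ip T"
    and a: "a > 0" and coercive: "\<And>x. a * (norm x)\<^sup>2 \<le> rip (T x) x"
  shows "bij T"
proof -
  interpret T: bounded_linear T by (rule positive_operatorD[OF T])
  obtain b r where b: "0 < b" and r: "0 < r" "r < 1"
    and le: "\<And>x. norm (x - (1 / b) *\<^sub>R T x) \<le> r * norm x"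
    using coercive_contraction[OF assms] by metis
  have "\<exists>!x. T x = y" for y
  proof -
    let ?\<Phi> = "\<lambda>x. x - (1 / b) *\<^sub>R T x + (1 / b) *\<^sub>R y"
    have "dist (?\<Phi> u) (?\<Phi> v) \<le> r * dist u v" for u v
      using le[of "u - v"] by (simp add: dist_norm T.diff algebra_simps)
    then have "\<exists>!x. ?\<Phi> x = x"
      using banach_fix_type[of r ?\<Phi>] r by simp
    moreover have "?\<Phi> x = x \<longleftrightarrow> T x = y" for x
    proof -
      have "?\<Phi> x = x \<longleftrightarrow> (1 / b) *\<^sub>R T x = (1 / b) *\<^sub>R y"
        by (auto simp: algebra_simps)
      then show ?thesis using b by simp
    qed
    ultimately show ?thesis by simp
  qed
  then show ?thesis by (simp add: bij_iff)
qed

text \<open>Write T = b (1 - X) with X a contraction. The fixed point \<open>Y\<close> satisfies (1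
  - Y)^2 = 1 - X, so R = sqrt b (1 - Y) is a root. Coercivity of \<open>R\<close> comes from
  \<open>norm Y \<le> r\<close> and \<open>r < 1\<close>, and commutation from the bicommutant
  clause.\<close>

lemma coercive_positive_sqrt:
  assumes T: "positive_operator smul ip T"
    and a: "a > 0" and coercive: "\<And>x. a * (norm x)\<^sup>2 \<le> rip (T x) x"
  obtains R c where "positive_operator smul ip R" "R \<circ> R = T"
    "c > 0" "\<And>x. c * (norm x)\<^sup>2 \<le> rip (R x) x"
    "\<And>Z x. bounded_linear Z \<Longrightarrow> Z \<circ> T = T \<circ> Z \<Longrightarrow> Z (R x) = R (Z x)"
proof -
  interpret T: bounded_linear T by (rule positive_operatorD[OF T])
  obtain b r where b: "0 < b" and r: "0 < r" "r < 1"
    and "positive_operator smul ip (\<lambda>x. x - (1 / b) *\<^sub>R T x)"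
    and "\<And>x. norm (x - (1 / b) *\<^sub>R T x) \<le> r * norm x"
    using coercive_contraction[OF assms] by blast
  moreover define X0 where "X0 x = x - (1 / b) *\<^sub>R T x" for x
  ultimately have X0: "positive_operator smul ip X0" and X0_le: "norm (X0 x) \<le> r * norm x" for x
    by (simp_all add: X0_def[abs_def])
  define X where "X = Blinfun X0"
  have X: "blinfun_apply X = X0"
    unfolding X_def by (rule bounded_linear_Blinfun_apply) (rule positive_operatorD[OF X0])
  \<comment> \<open>The commutation clause is trivial for \<open>X\<close> itself.\<close>
  have "X \<in> selfadjoint_commuting_ball X r"
    using X0_le r positive_operatorD[OF X0]
    by (auto simp: selfadjoint_commuting_ball_def X intro!: norm_blinfun_bound)
  then obtain Y where Y: "Y \<in> selfadjoint_commuting_ball X r" "2 *\<^sub>R Y = X + (Y o\<^sub>L Y)"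
    using sqrt_fixed_point[OF r] by blast
  have Yfix: "2 *\<^sub>R Y x = X0 x + Y (Y x)" for x
    using arg_cong[OF Y(2), of "\<lambda>W. blinfun_apply W x"] by (simp add: blinfun.bilinear_simps X)
  define R where "R x = sqrt b *\<^sub>R (x - Y x)" for x
  define c where "c = sqrt b * (1 - r)"
  have c: "c > 0" using b r by (simp add: c_def)
  have R_coercive: "c * (norm x)\<^sup>2 \<le> rip (R x) x" for x
  proof -
    have "rip (Y x) x \<le> norm (Y x) * norm x" by (rule rip_le)
    also have "\<dots> \<le> (norm Y * norm x) * norm x"
      by (intro mult_right_mono norm_blinfun) auto
    also have "\<dots> \<le> (r * norm x) * norm x"
      using selfadjoint_commuting_ballD(1)[OF Y(1)] by (intro mult_right_mono) auto
    finally have "(1 - r) * (norm x)\<^sup>2 \<le> (norm x)\<^sup>2 - rip (Y x) x"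
      by (simp add: power2_eq_square algebra_simps)
    then have "sqrt b * ((1 - r) * (norm x)\<^sup>2) \<le> sqrt b * ((norm x)\<^sup>2 - rip (Y x) x)"
      using b by (intro mult_left_mono) auto
    then show ?thesis
      by (simp add: c_def R_def rip_scaleR_left rip_diff_left rip_self mult.assoc)
  qed
  have "positive_operator smul ip R"
  proof (rule positive_operatorI)
    show "bounded_linear R"
      unfolding R_def by (intro bounded_linear_intros)
    show "R (smul c x) = smul c (R x)" for c x
      by (simp add: R_def selfadjoint_commuting_ballD(2)[OF Y(1)] scale_right_diff_distrib
          mult.commute flip: scale_of_real)
    show "ip (R x) y = ip x (R y)" for x y
      by (simp add: R_def selfadjoint_commuting_ballD(3)[OF Y(1)] ip_diff ip_scale_left ip_scale_right
          flip: scale_of_real)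
    show "0 \<le> rip (R x) x" for x
      using R_coercive[of x] c by (smt (verit) mult_nonneg_nonneg zero_le_power2)
  qed
  moreover have "R \<circ> R = T"
  proof
    fix x
    have "R (R x) = b *\<^sub>R (x - 2 *\<^sub>R Y x + Y (Y x))"
      using b by (simp add: R_def blinfun.bilinear_simps algebra_simps scaleR_2)
    also have "\<dots> = b *\<^sub>R (x - X0 x)" by (simp add: Yfix)
    also have "\<dots> = T x" using b by (simp add: X0_def)
    finally show "(R \<circ> R) x = T x" by simp
  qed
  moreover have "Z (R x) = R (Z x)" if Z: "bounded_linear Z" "Z \<circ> T = T \<circ> Z" for Z x
  proof -
    interpret Z: bounded_linear Z by (rule Z)
    have ZT: "Z (T x) = T (Z x)" for x
      using Z(2) by (metis comp_apply)
    have B: "blinfun_apply (Blinfun Z) = Z"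
      by (rule bounded_linear_Blinfun_apply) (rule Z)
    \<comment> \<open>\<open>X0\<close> is a combination of the identity and \<open>T\<close>, so
      \<open>Z\<close> commutes with it.\<close>
    have "Blinfun Z o\<^sub>L X = X o\<^sub>L Blinfun Z"
      by (rule blinfun_eqI) (simp add: B X X0_def Z.diff Z.scaleR ZT)
    then have "Blinfun Z o\<^sub>L Y = Y o\<^sub>L Blinfun Z"
      by (rule selfadjoint_commuting_ballD(4)[OF Y(1)])
    then have "Z (Y x) = Y (Z x)" for x
      by (metis B blinfun_apply_blinfun_compose)
    then show ?thesis by (simp add: R_def Z.diff Z.scaleR)
  qed
  ultimately show thesis using that c R_coercive by blast
qed

text \<open>Uniqueness of the root justifies the definite description in
  \<open>positive_sqrt\<close>. Another positive root \<open>Q\<close> commutes with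
  \<open>R\<close>, hence (Q + R)(Q - R) = 0; pairing with y = (Q - R) x and using coercivity of
  \<open>R\<close> forces y = 0.\<close>

lemma coercive_positive_sqrt_eq:
  assumes T: "positive_operator smul ip T"
    and a: "a > 0" and coercive: "\<And>x. a * (norm x)\<^sup>2 \<le> rip (T x) x"
  shows "positive_operator smul ip (positive_sqrt smul ip T)"
    and "positive_sqrt smul ip T \<circ> positive_sqrt smul ip T = T"
proof -
  obtain R c where R: "positive_operator smul ip R" "R \<circ> R = T"
    and c: "c > 0" "\<And>x. c * (norm x)\<^sup>2 \<le> rip (R x) x"
    and comm: "\<And>Z x. bounded_linear Z \<Longrightarrow> Z \<circ> T = T \<circ> Z \<Longrightarrow> Z (R x) = R (Z x)"
    using coercive_positive_sqrt[OF assms] by blast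
  have "Q = R" if Q: "positive_operator smul ip Q" "Q \<circ> Q = T" for Q
  proof
    fix x
    interpret Q: bounded_linear Q by (rule positive_operatorD[OF Q(1)])
    interpret R: bounded_linear R by (rule positive_operatorD[OF R(1)])
    have QR: "Q (R x) = R (Q x)" for x
      \<comment> \<open>\<open>Q\<close> commutes with its own square, which is
        \<open>T\<close>.\<close>
      using comm[OF positive_operatorD(1)[OF Q(1)]] Q(2) by (auto simp: comp_assoc)
    define y where "y = Q x - R x"
    have "Q (Q x) = R (R x)"
      using fun_cong[OF Q(2), of x] fun_cong[OF R(2), of x] by simp
    then have "Q y + R y = 0"
      by (simp add: y_def Q.diff R.diff QR)
    then have "rip (Q y) y + rip (R y) y = 0"
      by (simp add: linear_0[OF linear_rip_left] flip: rip_add_left)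
    then have "c * (norm y)\<^sup>2 \<le> 0"
      using positive_operatorD(5)[OF Q(1), of y] c(2)[of y] by linarith
    then show "Q x = R x"
      using c(1) by (simp add: y_def mult_le_0_iff)
  qed
  then have "positive_sqrt smul ip T = R"
    unfolding positive_sqrt_def using R by (intro the_equality) blast+
  then show "positive_operator smul ip (positive_sqrt smul ip T)"
    "positive_sqrt smul ip T \<circ> positive_sqrt smul ip T = T"
    using R by auto
qed

text \<open>Provides the hypotheses for taking the square root of the inverse. Coercivity of
  \<open>T\<close> at \<open>inv T x\<close> bounds the form of the inverse below by
  \<open>a\<close> times the squared norm of \<open>inv T x\<close>; the bound \<open>K\<close> of
  \<open>T\<close> turns this into the constant \<open>a / K\<^sup>2\<close>.\<close>

lemma coercive_inv:
  assumes T: "positive_operator smul ip T"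
    and a: "a > 0" and coercive: "\<And>x. a * (norm x)\<^sup>2 \<le> rip (T x) x"
  obtains c where "c > 0" "positive_operator smul ip (inv T)"
    "\<And>x. c * (norm x)\<^sup>2 \<le> rip (inv T x) x"
proof -
  interpret T: bounded_linear T by (rule positive_operatorD[OF T])
  have inv: "inv T (T x) = x" "T (inv T x) = x" for x
    using coercive_bij[OF assms] by (simp_all add: bij_is_inj bij_is_surj surj_f_inv_f)
  have inv_rip: "a * (norm (inv T x))\<^sup>2 \<le> rip (inv T x) x" for x
    using coercive[of "inv T x"] by (simp add: inv rip_commute)
  obtain K where K: "K > 0" "\<And>x. norm (T x) \<le> norm x * K" using T.pos_bounded by blast
  have "positive_operator smul ip (inv T)"
  proof (rule positive_operatorI)
    have "norm (inv T x) \<le> norm x * (1 / a)" for x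
    proof -
      have "a * (norm (inv T x))\<^sup>2 \<le> norm (inv T x) * norm x"
        using inv_rip rip_le by (rule order.trans)
      then have "a * norm (inv T x) \<le> norm x"
        by (cases "inv T x = 0") (simp_all add: power2_eq_square)
      then show ?thesis using a by (simp add: field_simps)
    qed
    moreover have "inv T (x + y) = inv T x + inv T y" for x y
      by (metis inv T.add)
    moreover have "inv T (t *\<^sub>R x) = t *\<^sub>R inv T x" for t x
      by (metis inv T.scaleR)
    ultimately show "bounded_linear (inv T)"
      by (rule bounded_linear_intro[rotated 2])
    show "inv T (smul c x) = smul c (inv T x)" for c x
      by (metis inv positive_operatorD(2)[OF T])
    show "ip (inv T x) y = ip x (inv T y)" for x y
      by (metis inv positive_operatorD(3)[OF T])
    show "0 \<le> rip (inv T x) x" for x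
      using inv_rip[of x] a by (smt (verit) mult_nonneg_nonneg zero_le_power2)
  qed
  moreover have "a / K\<^sup>2 * (norm x)\<^sup>2 \<le> rip (inv T x) x" for x
  proof -
    have "norm x \<le> norm (inv T x) * K" using K(2)[of "inv T x"] by (simp add: inv)
    then have "(norm x)\<^sup>2 \<le> (norm (inv T x) * K)\<^sup>2" by (intro power_mono) auto
    then have "a * (norm x)\<^sup>2 \<le> a * (norm (inv T x) * K)\<^sup>2"
      using a by (intro mult_left_mono) auto
    then have "a / K\<^sup>2 * (norm x)\<^sup>2 \<le> a * (norm (inv T x))\<^sup>2"
      using K(1) by (simp add: field_simps)
    then show ?thesis using inv_rip[of x] by simp
  qed
  ultimately show thesis using that[of "a / K\<^sup>2"] a K(1) by simp
qed

section \<open>Synthesis with Bessel families\<close>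

text \<open>Pair the sum with itself and split each product by a weighted arithmetic-geometric mean
  inequality. The Bessel bound then turns the analysis part into half the squared norm of the sum,
  which is absorbed on the left.\<close>

lemma norm_synthesis_le:
  assumes F: "finite F" and B: "B > 0"
    and bessel: "\<And>x. (\<Sum>k\<in>F. (norm (ip x (g k)))\<^sup>2) \<le> B * (norm x)\<^sup>2"
  shows "(norm (\<Sum>k\<in>F. smul (c k) (g k)))\<^sup>2 \<le> B * (\<Sum>k\<in>F. (norm (c k))\<^sup>2)"
proof -
  define v where "v = (\<Sum>k\<in>F. smul (c k) (g k))"
  have "(norm v)\<^sup>2 = (\<Sum>k\<in>F. rip (smul (c k) (g k)) v)"
    unfolding rip_self[symmetric] by (subst (1) v_def) (rule linear_sum[OF linear_rip_left])
  also have "\<dots> \<le> (\<Sum>k\<in>F. B / 2 * (norm (c k))\<^sup>2 + 1 / (2 * B) * (norm (ip v (g k)))\<^sup>2)"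
  proof (rule sum_mono)
    fix k
    define s t where "s = norm (c k)" and "t = norm (ip v (g k))"
    have "rip (smul (c k) (g k)) v \<le> norm (c k * ip (g k) v)"
      using abs_re_part_le[of "c k * ip (g k) v"] by (simp add: rip_def ip_scale_left)
    also have "\<dots> = s * t"
      unfolding s_def t_def by (simp add: norm_mult ip_kconj[of v "g k"])
    also have "\<dots> \<le> B / 2 * s\<^sup>2 + 1 / (2 * B) * t\<^sup>2"
    proof -
      \<comment> \<open>The weight \<open>B\<close> is chosen so that the \<open>t\<close> terms sum
        to at most half of \<open>(norm v)\<^sup>2\<close>.\<close>
      have "0 \<le> (B * s - t)\<^sup>2 / (2 * B)" using B by simp
      also have "\<dots> = B / 2 * s\<^sup>2 + 1 / (2 * B) * t\<^sup>2 - s * t"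
        using B by (simp add: field_simps power2_eq_square)
      finally show ?thesis by simp
    qed
    finally show "rip (smul (c k) (g k)) v \<le>
        B / 2 * (norm (c k))\<^sup>2 + 1 / (2 * B) * (norm (ip v (g k)))\<^sup>2"
      unfolding s_def t_def .
  qed
  also have "\<dots> = B / 2 * (\<Sum>k\<in>F. (norm (c k))\<^sup>2) + 1 / (2 * B) * (\<Sum>k\<in>F. (norm (ip v (g k)))\<^sup>2)"
    by (simp add: sum.distrib sum_distrib_left)
  also have "\<dots> \<le> B / 2 * (\<Sum>k\<in>F. (norm (c k))\<^sup>2) + 1 / (2 * B) * (B * (norm v)\<^sup>2)"
    using B bessel by (intro add_left_mono mult_left_mono) auto
  finally show ?thesis using B by (simp add: v_def)
qed

text \<open>The finite partial sums form a Cauchy net, since their differences are controlled by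
  \<open>B\<close> times tails of the convergent series of squared coefficients. Completeness
  provides the limit.\<close>

lemma summable_on_synthesis:
  assumes B: "B > 0"
    and bessel: "\<And>F x. finite F \<Longrightarrow> F \<subseteq> K \<Longrightarrow> (\<Sum>k\<in>F. (norm (ip x (g k)))\<^sup>2) \<le> B * (norm x)\<^sup>2"
    and c: "(\<lambda>k. (norm (c k))\<^sup>2) summable_on K"
  shows "(\<lambda>k. smul (c k) (g k)) summable_on K"
proof -
  define s v where "s F = (\<Sum>k\<in>F. (norm (c k))\<^sup>2)" and "v F = (\<Sum>k\<in>F. smul (c k) (g k))" for F
  have "\<exists>P. eventually P (finite_subsets_at_top K) \<and> (\<forall>F F'. P F \<and> P F' \<longrightarrow> dist (v F) (v F') < e)"
    if e: "e > 0" for e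
  proof -
    \<comment> \<open>This makes \<open>B * d\<close> equal to one eighth of
      \<open>e\<^sup>2\<close>, strictly below \<open>(e / 2)\<^sup>2\<close>.\<close>
    define d where "d = e\<^sup>2 / (8 * B)"
    have "d > 0" using e B by (simp add: d_def)
    then obtain F0 where F0: "finite F0" "F0 \<subseteq> K"
      and close: "dist (s F0) (infsum (\<lambda>k. (norm (c k))\<^sup>2) K) \<le> d"
      using infsum_finite_approximation[OF c] unfolding s_def by blast
    have near: "dist (v F) (v F0) < e / 2" if F: "finite F" "F0 \<subseteq> F" "F \<subseteq> K" for F
    proof -
      have "(norm (v F - v F0))\<^sup>2 = (norm (v (F - F0)))\<^sup>2"
        using F by (simp add: v_def sum_diff)
      also have "\<dots> \<le> B * s (F - F0)"
        unfolding v_def s_def using F by (intro norm_synthesis_le B bessel) auto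
      also have "\<dots> = B * (s F - s F0)"
        using F by (simp add: s_def sum_diff)
      also have "\<dots> \<le> B * d"
      proof -
        have "s F \<le> infsum (\<lambda>k. (norm (c k))\<^sup>2) K"
          unfolding s_def using F by (intro finite_sum_le_infsum c) auto
        then show ?thesis
          using close B by (intro mult_left_mono) (auto simp: dist_real_def)
      qed
      also have "\<dots> < (e / 2)\<^sup>2"
        using e B by (simp add: d_def field_simps power2_eq_square)
      finally show ?thesis
        unfolding dist_norm by (rule power2_less_imp_less) (use e in simp)
    qed
    define P where "P F \<longleftrightarrow> finite F \<and> F0 \<subseteq> F \<and> F \<subseteq> K" for F
    have "eventually P (finite_subsets_at_top K)"
      unfolding eventually_finite_subsets_at_top P_def using F0 by blast
    moreover have "dist (v F) (v F') < e" if "P F" "P F'" for F F'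
      using near[of F] near[of F'] dist_triangle2[of "v F" "v F'" "v F0"] that
      by (simp add: P_def)
    ultimately show ?thesis by blast
  qed
  then have "cauchy_filter (filtermap v (finite_subsets_at_top K))"
    by (simp add: cauchy_filter_metric_filtermap)
  then have "convergent_filter (filtermap v (finite_subsets_at_top K))"
    by (rule cauchy_filter_convergent)
  then obtain l where "(v \<longlongrightarrow> l) (finite_subsets_at_top K)"
    by (auto simp: convergent_filter_iff filterlim_def)
  then show ?thesis
    unfolding summable_on_def has_sum_def v_def by blast
qed

section \<open>The frame operator and its canonical tight frame\<close>

text \<open>Indexed by an arbitrary set, so that a woven family is treated as one frame over the
  pairs \<open>(j, i)\<close>.\<close>

definition frame_operator :: "'j set \<Rightarrow> ('j \<Rightarrow> 'a) \<Rightarrow> 'a \<Rightarrow> 'a" where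
  "frame_operator K g x = (\<Sum>\<^sub>\<infinity>k\<in>K. smul (ip x (g k)) (g k))"

lemma is_frame_finite_sum_le:
  assumes "is_frame ip K g A B" "finite F" "F \<subseteq> K"
  shows "(\<Sum>k\<in>F. (norm (ip x (g k)))\<^sup>2) \<le> B * (norm x)\<^sup>2"
proof -
  have "(\<Sum>k\<in>F. (norm (ip x (g k)))\<^sup>2) \<le> (\<Sum>\<^sub>\<infinity>k\<in>K. (norm (ip x (g k)))\<^sup>2)"
    using assms by (intro finite_sum_le_infsum) (auto simp: is_frame_def)
  also have "\<dots> \<le> B * (norm x)\<^sup>2"
    using assms by (auto simp: is_frame_def)
  finally show ?thesis .
qed

lemma has_sum_frame_operator:
  assumes "is_frame ip K g A B"
  shows "((\<lambda>k. smul (ip x (g k)) (g k)) has_sum frame_operator K g x) K"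
  unfolding frame_operator_def
  using assms by (intro has_sum_infsum summable_on_synthesis[of B] is_frame_finite_sum_le[OF assms])
    (auto simp: is_frame_def)

text \<open>Pairing with \<open>x\<close> and taking real parts are bounded linear, so they pass
  through the sum; each term becomes a squared frame coefficient.\<close>

lemma has_sum_rip_frame_operator:
  assumes "is_frame ip K g A B"
  shows "((\<lambda>k. (norm (ip x (g k)))\<^sup>2) has_sum rip (frame_operator K g x) x) K"
proof -
  have "bounded_linear (re_part :: 'k \<Rightarrow> real)"
    using linear_re_part abs_re_part_le
    by (intro bounded_linear.intro bounded_linear_axioms.intro exI[of _ 1]) auto
  then have "((\<lambda>k. re_part (ip (smul (ip x (g k)) (g k)) x)) has_sum rip (frame_operator K g x) x) K"
    unfolding rip_def by (intro has_sum_bounded_linear[OF _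
          has_sum_bounded_linear[OF bounded_linear_ip_left has_sum_frame_operator[OF assms]]])
  moreover have "re_part (ip (smul (ip x (g k)) (g k)) x) = (norm (ip x (g k)))\<^sup>2" for k
    by (simp add: ip_scale_left ip_kconj[of "g k" x] mult_kconj scaleR_conv_of_real
        del: of_real_power)
  ultimately show ?thesis by simp
qed

lemma frame_operator_coercive:
  assumes "is_frame ip K g A B"
  shows "A * (norm x)\<^sup>2 \<le> rip (frame_operator K g x) x"
  using assms infsumI[OF has_sum_rip_frame_operator[OF assms, of x]]
  unfolding is_frame_def by metis

text \<open>Linearity and self-adjointness hold termwise and pass to the sums by uniqueness of
  limits. Boundedness comes from a uniform bound on the finite partial sums.\<close>

lemma positive_frame_operator:
  assumes fr: "is_frame ip K g A B"
  shows "positive_operator smul ip (frame_operator K g)"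
proof (rule positive_operatorI)
  let ?S = "frame_operator K g"
  note sums = has_sum_frame_operator[OF fr]
  have B: "B > 0" using fr by (simp add: is_frame_def)
  show scale: "?S (smul c x) = smul c (?S x)" for c x
  proof (rule has_sum_unique[OF sums])
    show "((\<lambda>k. smul (ip (smul c x) (g k)) (g k)) has_sum smul c (?S x)) K"
      using has_sum_bounded_linear[OF bounded_linear_scale sums, of c x] by (simp add: ip_scale_left)
  qed
  show "bounded_linear ?S"
  proof (rule bounded_linear_intro[where K = B])
    show "?S (x + y) = ?S x + ?S y" for x y
    proof (rule has_sum_unique[OF sums])
      show "((\<lambda>k. smul (ip (x + y) (g k)) (g k)) has_sum (?S x + ?S y)) K"
        using has_sum_add[OF sums[of x] sums[of y]] by (simp add: ip_add_left scale_left_distrib)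
    qed
    show "?S (r *\<^sub>R x) = r *\<^sub>R ?S x" for r x
      using scale[of "of_real r"] by (simp add: scale_of_real)
    show "norm (?S x) \<le> norm x * B" for x
    proof (rule Lim_norm_ubound)
      show "(sum (\<lambda>k. smul (ip x (g k)) (g k)) \<longlongrightarrow> ?S x) (finite_subsets_at_top K)"
        using sums[of x] by (simp add: has_sum_def)
      have "norm (\<Sum>k\<in>F. smul (ip x (g k)) (g k)) \<le> norm x * B" if F: "finite F" "F \<subseteq> K" for F
      proof -
        \<comment> \<open>The synthesis bound and the Bessel bound each contribute a factor
          \<open>B\<close>.\<close>
        have "(norm (\<Sum>k\<in>F. smul (ip x (g k)) (g k)))\<^sup>2 \<le> B * (\<Sum>k\<in>F. (norm (ip x (g k)))\<^sup>2)"
          using F by (intro norm_synthesis_le B is_frame_finite_sum_le[OF fr])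
        also have "\<dots> \<le> B * (B * (norm x)\<^sup>2)"
          using F B by (intro mult_left_mono is_frame_finite_sum_le[OF fr]) auto
        also have "\<dots> = (norm x * B)\<^sup>2" by (simp add: power2_eq_square)
        finally show ?thesis using B by (auto intro: power2_le_imp_le)
      qed
      then show "\<forall>\<^sub>F F in finite_subsets_at_top K.
          norm (\<Sum>k\<in>F. smul (ip x (g k)) (g k)) \<le> norm x * B"
        by (intro eventually_finite_subsets_at_top_weakI)
    qed simp
  qed
  show "ip (?S x) y = ip x (?S y)" for x y
  proof (rule has_sum_unique)
    show "((\<lambda>k. ip (smul (ip x (g k)) (g k)) y) has_sum ip (?S x) y) K"
      by (rule has_sum_bounded_linear[OF bounded_linear_ip_left sums])
    have "((\<lambda>k. ip x (smul (ip y (g k)) (g k))) has_sum ip x (?S y)) K"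
      by (rule has_sum_bounded_linear[OF bounded_linear_ip_right sums])
    then show "((\<lambda>k. ip (smul (ip x (g k)) (g k)) y) has_sum ip x (?S y)) K"
      by (simp add: ip_scale_left ip_scale_right ip_kconj[of "g _" y] mult.commute)
  qed
  show "0 \<le> rip (?S x) x" for x
    by (rule has_sum_nonneg[OF has_sum_rip_frame_operator[OF fr]]) simp
qed

text \<open>Self-adjointness moves \<open>R\<close> from the frame vectors onto \<open>x\<close>.
  Both sums then become those of the frame operator at \<open>R x\<close>, and R S R = 1 evaluates
  them.\<close>

lemma canonical_tight_frame:
  assumes fr: "is_frame ip K g A B"
  defines "R \<equiv> positive_sqrt smul ip (inv (frame_operator K g))"
  shows "((\<lambda>k. (norm (ip x (R (g k))))\<^sup>2) has_sum (norm x)\<^sup>2) K"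
    and "((\<lambda>k. smul (ip x (R (g k))) (R (g k))) has_sum x) K"
proof -
  let ?S = "frame_operator K g"
  have A: "A > 0" using fr by (simp add: is_frame_def)
  note S = positive_frame_operator[OF fr] A frame_operator_coercive[OF fr]
  obtain c where c: "c > 0" "positive_operator smul ip (inv ?S)"
    "\<And>x. c * (norm x)\<^sup>2 \<le> rip (inv ?S x) x"
    using coercive_inv[OF S] by blast
  have R: "positive_operator smul ip R" and RR: "R (R x) = inv ?S x" for x
    using coercive_positive_sqrt_eq[OF c(2,1,3)] by (auto simp: R_def fun_eq_iff)
  have inv: "inv ?S (?S x) = x" "?S (inv ?S x) = x" for x
    using coercive_bij[OF S] by (simp_all add: bij_is_inj bij_is_surj surj_f_inv_f)
  have inj: "inj R"
    by (rule inj_on_inverseI[of _ "\<lambda>y. ?S (R y)"]) (simp add: RR inv)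
  \<comment> \<open>After applying the injective \<open>R\<close> once more, both sides equal
    \<open>R x\<close>, because \<open>R\<close> squares to the inverse of the frame
    operator.\<close>
  have RSR: "R (?S (R x)) = x" for x
    by (rule injD[OF inj]) (simp add: RR inv)
  have ip_R: "ip x (R y) = ip (R x) y" for x y
    by (rule positive_operatorD(3)[OF R, symmetric])
  have "rip (?S (R x)) (R x) = (norm x)\<^sup>2"
    using positive_operatorD(4)[OF R, of "?S (R x)" x] by (simp add: RSR rip_self)
  then show "((\<lambda>k. (norm (ip x (R (g k))))\<^sup>2) has_sum (norm x)\<^sup>2) K"
    using has_sum_rip_frame_operator[OF fr, of "R x"] by (simp add: ip_R)
  show "((\<lambda>k. smul (ip x (R (g k))) (R (g k))) has_sum x) K"
    using has_sum_bounded_linear[OF positive_operatorD(1)[OF R] has_sum_frame_operator[OF fr, of "R x"]]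
    by (simp add: positive_operatorD(2)[OF R] RSR ip_R)
qed

section \<open>From one frame to all weavings\<close>

text \<open>Summability over the pairs allows the sum to be iterated, with the finite sum over
  \<open>j\<close> outside.\<close>

lemma woven_frame_operator_eq_frame_operator:
  assumes "is_frame ip (SIGMA j:{1..m}. \<sigma> j) (\<lambda>(j, i). f i j) A B"
  shows "woven_frame_operator smul ip m f \<sigma> =
    frame_operator (SIGMA j:{1..m}. \<sigma> j) (\<lambda>(j, i). f i j)"
proof
  fix x
  show "woven_frame_operator smul ip m f \<sigma> x =
      frame_operator (SIGMA j:{1..m}. \<sigma> j) (\<lambda>(j, i). f i j) x"
    using infsum_Sigma_banach[OF has_sum_imp_summable[OF has_sum_frame_operator[OF assms]], of x]
    by (simp add: woven_frame_operator_def frame_operator_def)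
qed

end

theorem theorem3p6:
  fixes smul :: "'k::rc_field \<Rightarrow> 'a::banach \<Rightarrow> 'a"
    and ip :: "'a \<Rightarrow> 'a \<Rightarrow> 'k"
    and I :: "'i set" and m :: nat
    and f :: "'i \<Rightarrow> nat \<Rightarrow> 'a"
    and C D :: real
  assumes hilbert: "hilbert_space smul ip"
    and separable: "separable_space (euclidean :: 'a topology)"
    and I: "countable I"
    and woven: "is_woven_frame ip I m f C D"
  shows "(\<exists>A>0. \<forall>\<sigma>. index_partition I m \<sigma> \<longrightarrow>
            is_tight_frame ip (SIGMA j:{1..m}. \<sigma> j)
              (\<lambda>(j, i). inv_sqrt_frame_operator smul ip m f \<sigma> (f i j)) A) \<and>
         (\<forall>\<sigma> x. index_partition I m \<sigma> \<longrightarrow>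
            (let g = (\<lambda>i j. inv_sqrt_frame_operator smul ip m f \<sigma> (f i j)) in
              (\<forall>j\<in>{1..m}. (\<lambda>i. smul (ip x (g i j)) (g i j)) summable_on \<sigma> j) \<and>
              x = (\<Sum>j\<in>{1..m}. \<Sum>\<^sub>\<infinity>i\<in>\<sigma> j. smul (ip x (g i j)) (g i j))))"
proof -
  interpret hilbert_space smul ip by (rule hilbert)
  have parseval: "((\<lambda>(j, i). (norm (ip x (inv_sqrt_frame_operator smul ip m f \<sigma> (f i j))))\<^sup>2)
        has_sum (norm x)\<^sup>2) (SIGMA j:{1..m}. \<sigma> j)"
    and expansion: "((\<lambda>(j, i). smul (ip x (inv_sqrt_frame_operator smul ip m f \<sigma> (f i j)))
        (inv_sqrt_frame_operator smul ip m f \<sigma> (f i j))) has_sum x) (SIGMA j:{1..m}. \<sigma> j)"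
    if "index_partition I m \<sigma>" for \<sigma> x
  proof -
    have "is_frame ip (SIGMA j:{1..m}. \<sigma> j) (\<lambda>(j, i). f i j) C D"
      using woven that unfolding is_woven_frame_def by blast
    from canonical_tight_frame[OF this, of x] woven_frame_operator_eq_frame_operator[OF this]
    show "((\<lambda>(j, i). (norm (ip x (inv_sqrt_frame_operator smul ip m f \<sigma> (f i j))))\<^sup>2)
        has_sum (norm x)\<^sup>2) (SIGMA j:{1..m}. \<sigma> j)"
      "((\<lambda>(j, i). smul (ip x (inv_sqrt_frame_operator smul ip m f \<sigma> (f i j)))
        (inv_sqrt_frame_operator smul ip m f \<sigma> (f i j))) has_sum x) (SIGMA j:{1..m}. \<sigma> j)"
      by (simp_all add: inv_sqrt_frame_operator_def case_prod_unfold)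
  qed
  show ?thesis
  \<comment> \<open>Every weaving becomes a Parseval frame, so the bound 1 serves all partitions at
    once.\<close>
  proof (intro conjI exI[of _ 1] allI impI)
    fix \<sigma> assume \<sigma>: "index_partition I m \<sigma>"
    show "is_tight_frame ip (SIGMA j:{1..m}. \<sigma> j)
        (\<lambda>(j, i). inv_sqrt_frame_operator smul ip m f \<sigma> (f i j)) 1"
      unfolding is_tight_frame_def is_frame_def
      using has_sum_imp_summable[OF parseval[OF \<sigma>]] infsumI[OF parseval[OF \<sigma>]]
      by (simp add: case_prod_unfold)
  next
    fix \<sigma> x assume \<sigma>: "index_partition I m \<sigma>"
    note summable = has_sum_imp_summable[OF expansion[OF \<sigma>, of x]]
    have "(\<lambda>i. smul (ip x (inv_sqrt_frame_operator smul ip m f \<sigma> (f i j)))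
        (inv_sqrt_frame_operator smul ip m f \<sigma> (f i j))) summable_on \<sigma> j" if "j \<in> {1..m}" for j
    proof -
      \<comment> \<open>Each inner family is the summable family over pairs restricted to the slice
        at \<open>j\<close>, reindexed by an injection.\<close>
      have "Pair j ` \<sigma> j \<subseteq> (SIGMA j:{1..m}. \<sigma> j)" using that by auto
      from summable_on_subset_banach[OF summable this] show ?thesis
        by (simp add: summable_on_reindex inj_on_def o_def)
    qed
    then show "let g = (\<lambda>i j. inv_sqrt_frame_operator smul ip m f \<sigma> (f i j)) in
        (\<forall>j\<in>{1..m}. (\<lambda>i. smul (ip x (g i j)) (g i j)) summable_on \<sigma> j) \<and>
        x = (\<Sum>j\<in>{1..m}. \<Sum>\<^sub>\<infinity>i\<in>\<sigma> j. smul (ip x (g i j)) (g i j))"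
      using infsum_Sigma'_banach[OF summable] infsumI[OF expansion[OF \<sigma>, of x]]
      by (simp add: Let_def)
  qed simp
qed

end
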